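(* For every $n\geq 10$, $$S_{\rm Sid}(n)=M_\Theta(n)=2n+1.$$
   Context: $\Theta$-property: a subset $S\subseteq\mathbb{Z}_2^n$ has the $\Theta$-property if for any three pairwise disjoint subsets of $S$ whose element sums are equal, at least two of the three subsets have even size. (An empty subset is allowed; its sum is $0$.) $S$ is a Sidon set if for all $a,b,c,d\in S$ with $a\ne b$, $c\neq d$ and $a+b=c+d$ one has $\{a,b\}=\{c,d\}$. $M_\Theta(n)$ denotes the maximum of $|S|$ over all subsets $S\subseteq\mathbb{Z}_2^n$ that generate $\mathbb{Z}_2^n$ and have the $\Theta$-property. $S_{\rm Sid}(n)$ denotes the maximum of $|S|$ over all Sidon subsets $S\subseteq\mathbb{Z}_2^n$ that generate $\mathbb{Z}_2^n$ and have the $\Theta$-property. In both definitions $S$ is allowed to contain $0$. *)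

theory Defs
  imports
    "HOL-Library.Z2"
    "HOL-Library.Function_Algebras"
    "HOL-Computational_Algebra.Group_Closure"
begin

text \<open>
  The group \<open>\<int>\<^sub>2\<^sup>n\<close>, with the natural number \<open>n\<close> as a parameter: vectors are functions
  from \<^typ>\<open>nat\<close> to the two-element field \<^typ>\<open>bit\<close> that vanish outside the coordinates
  \<open>0, \<dots>, n - 1\<close>. Addition and sums are pointwise (theory \<open>Function_Algebras\<close>).
\<close>

definition Z2n :: "nat \<Rightarrow> (nat \<Rightarrow> bit) set" where
  "Z2n n = {v. \<forall>i\<ge>n. v i = 0}"

text \<open>
  Sizes and element sums are meant for finite sets; below, \<open>S\<close> is always a subset of the finite
  set \<^term>\<open>Z2n n\<close>. Requiring \<open>A\<close>, \<open>B\<close>, \<open>C\<close> to be distinct as well would change nothing: two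
  disjoint sets that coincide are empty, hence both of even size.
\<close>

definition theta_property :: "'a::ab_group_add set \<Rightarrow> bool" where
  "theta_property S \<longleftrightarrow>
    (\<forall>A B C. A \<subseteq> S \<and> B \<subseteq> S \<and> C \<subseteq> S \<and>
       A \<inter> B = {} \<and> A \<inter> C = {} \<and> B \<inter> C = {} \<and>
       \<Sum>A = \<Sum>B \<and> \<Sum>B = \<Sum>C \<longrightarrow>
       (even (card A) \<and> even (card B)) \<or>
       (even (card A) \<and> even (card C)) \<or>
       (even (card B) \<and> even (card C)))"

definition sidon :: "'a::ab_group_add set \<Rightarrow> bool" where
  "sidon S \<longleftrightarrow>
    (\<forall>a\<in>S. \<forall>b\<in>S. \<forall>c\<in>S. \<forall>d\<in>S.
       a \<noteq> b \<and> c \<noteq> d \<and> a + b = c + d \<longrightarrow> {a, b} = {c, d})"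

definition generating_theta_sets :: "nat \<Rightarrow> (nat \<Rightarrow> bit) set set" where
  "generating_theta_sets n =
    {S. S \<subseteq> Z2n n \<and> group_closure S = Z2n n \<and> theta_property S}"

definition M_Theta :: "nat \<Rightarrow> nat" where
  "M_Theta n = Max (card ` generating_theta_sets n)"

definition S_Sid :: "nat \<Rightarrow> nat" where
  "S_Sid n = Max (card ` {S \<in> generating_theta_sets n. sidon S})"

text \<open>
  Both maxima range over finite nonempty sets, so that \<^const>\<open>Max\<close> has its intended meaning:
  the standard basis is a Sidon set that generates and has the \<open>\<Theta>\<close>-property.
\<close>

lemma finite_Z2n: "finite (Z2n n)"
proof (rule finite_subset)
  show "Z2n n \<subseteq> (\<lambda>A i. if i \<in> A then 1 else 0) ` Pow {..<n}"
  proof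
    fix v assume v: "v \<in> Z2n n"
    have "v = (\<lambda>i. if i \<in> {i. v i = 1} then 1 else 0)"
      by (rule ext) simp
    moreover have "{i. v i = 1} \<in> Pow {..<n}"
      using v by (auto simp: Z2n_def not_le[symmetric])
    ultimately show "v \<in> (\<lambda>A i. if i \<in> A then 1 else 0) ` Pow {..<n}"
      by (rule image_eqI)
  qed
qed simp

lemma finite_generating_theta_sets: "finite (generating_theta_sets n)"
  by (rule finite_subset[of _ "Pow (Z2n n)"])
    (auto simp: generating_theta_sets_def finite_Z2n)

definition unit_vec :: "nat \<Rightarrow> nat \<Rightarrow> bit" where
  "unit_vec i = (\<lambda>j. if j = i then 1 else 0)"

lemma inj_unit_vec: "inj unit_vec"
  by (rule injI) (metis unit_vec_def zero_neq_one)

lemma sum_fun_apply: "(sum f A) i = (\<Sum>x\<in>A. f x i)"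
  by (induction A rule: infinite_finite_induct) auto

lemma sum_unit_vecs:
  assumes "finite I"
  shows "\<Sum>(unit_vec ` I) = (\<lambda>i. if i \<in> I then 1 else 0)"
proof
  fix i
  have "\<Sum>(unit_vec ` I) = sum unit_vec I"
    using inj_unit_vec by (simp add: sum.reindex inj_on_subset)
  then have "(\<Sum>(unit_vec ` I)) i = (\<Sum>j\<in>I. unit_vec j i)"
    by (simp only: sum_fun_apply)
  also have "\<dots> = (if i \<in> I then 1 else 0)"
    using assms by (simp add: unit_vec_def)
  finally show "(\<Sum>(unit_vec ` I)) i = (if i \<in> I then 1 else 0)" .
qed

lemma sum_unit_vecs_inj:
  assumes "A \<subseteq> unit_vec ` {..<n}" "B \<subseteq> unit_vec ` {..<n}" "\<Sum>A = \<Sum>B"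
  shows "A = B"
proof -
  obtain I J where I: "I \<subseteq> {..<n}" "A = unit_vec ` I" and J: "J \<subseteq> {..<n}" "B = unit_vec ` J"
    using assms(1,2) by (meson subset_imageE)
  then have fin: "finite I" "finite J"
    by (auto intro: finite_subset)
  have "(\<lambda>i. if i \<in> I then 1 else 0 :: bit) = (\<lambda>i. if i \<in> J then 1 else 0)"
    using assms(3) fin by (simp only: I J sum_unit_vecs)
  then have "I = J"
    by (metis (no_types, lifting) zero_neq_one set_eqI)
  then show ?thesis
    by (simp add: I J)
qed

lemma sidon_unit_vecs: "sidon (unit_vec ` {..<n})"
  unfolding sidon_def
proof (intro ballI impI)
  fix a b c d
  assume *: "a \<in> unit_vec ` {..<n}" "b \<in> unit_vec ` {..<n}"
    "c \<in> unit_vec ` {..<n}" "d \<in> unit_vec ` {..<n}"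
  assume "a \<noteq> b \<and> c \<noteq> d \<and> a + b = c + d"
  then have "\<Sum>{a, b} = \<Sum>{c, d}"
    by simp
  with * show "{a, b} = {c, d}"
    by (intro sum_unit_vecs_inj[of _ n]) simp_all
qed

lemma theta_property_unit_vecs: "theta_property (unit_vec ` {..<n})"
  unfolding theta_property_def
proof (intro allI impI)
  fix A B C
  assume *: "A \<subseteq> unit_vec ` {..<n} \<and> B \<subseteq> unit_vec ` {..<n} \<and> C \<subseteq> unit_vec ` {..<n} \<and>
    A \<inter> B = {} \<and> A \<inter> C = {} \<and> B \<inter> C = {} \<and> \<Sum>A = \<Sum>B \<and> \<Sum>B = \<Sum>C"
  then have "A = B"
    by (intro sum_unit_vecs_inj[of _ n]) simp_all
  with * have "A = {}" "B = {}"
    by auto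
  then show "(even (card A) \<and> even (card B)) \<or> (even (card A) \<and> even (card C)) \<or>
      (even (card B) \<and> even (card C))"
    by simp
qed

lemma sum_in_group_closure:
  assumes "A \<subseteq> group_closure S"
  shows "\<Sum>A \<in> group_closure S"
  using assms by (induction A rule: infinite_finite_induct) (auto intro: group_closure_add)

lemma group_closure_unit_vecs: "group_closure (unit_vec ` {..<n}) = Z2n n"
proof
  show "group_closure (unit_vec ` {..<n}) \<subseteq> Z2n n"
  proof
    fix v assume "v \<in> group_closure (unit_vec ` {..<n})"
    then show "v \<in> Z2n n"
      by induction (auto simp: Z2n_def unit_vec_def)
  qed
  show "Z2n n \<subseteq> group_closure (unit_vec ` {..<n})"
  proof
    fix v assume v: "v \<in> Z2n n"
    let ?I = "{i. v i = 1}"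
    have I: "?I \<subseteq> {..<n}"
      using v by (auto simp: Z2n_def not_le[symmetric])
    then have "v = \<Sum>(unit_vec ` ?I)"
      by (subst sum_unit_vecs) (auto intro: finite_subset)
    also have "\<dots> \<in> group_closure (unit_vec ` {..<n})"
      using I by (intro sum_in_group_closure) (auto intro: group_closure.base)
    finally show "v \<in> group_closure (unit_vec ` {..<n})" .
  qed
qed

lemma unit_vecs_generating_theta: "unit_vec ` {..<n} \<in> generating_theta_sets n"
  unfolding generating_theta_sets_def
  by (simp add: theta_property_unit_vecs group_closure_unit_vecs)
    (auto simp: Z2n_def unit_vec_def)

lemma unit_vecs_generating_sidon:
  "unit_vec ` {..<n} \<in> {S \<in> generating_theta_sets n. sidon S}"
  by (simp add: unit_vecs_generating_theta sidon_unit_vecs)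

end

theory Submission
  imports Defs
begin

text \<open>
  Call \<open>A \<subseteq> S\<close> a relation if its elements sum to \<open>0\<close>. Three disjoint sets with equal sums are the
  intersection and the two differences of two relations \<open>A\<close>, \<open>B\<close>, so the \<open>\<Theta>\<close>-property says that
  \<open>card (A \<inter> B)\<close> and \<open>card A * card B\<close> always have the same parity. After adding a parity
  coordinate, the relations thus form a self-orthogonal binary code of length \<open>card S + 1\<close> and
  dimension at least \<open>card S - n\<close>, which forces \<open>card S \<le> 2 * n + 1\<close>.

  Equality means a self-dual code of length \<open>2 * n + 2\<close>, and minimum distance at least \<open>6\<close> makes \<open>S\<close>
  a Sidon set. Such a code is extended from \<open>n\<close> to \<open>n + 1\<close> by a vector \<open>w\<close> that is not a sum of at
  most three elements of \<open>S\<close>. For \<open>n \<ge> 12\<close> such a \<open>w\<close> exists because there are fewer than \<open>2 ^ n\<close>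
  subsets of size at most three; explicit codes serve for \<open>n = 10, 11, 12\<close>.
\<close>

section \<open>Upper bound\<close>

declare add_bit_eq_xor [simp del] mult_bit_eq_and [simp del]

lemma bit_add_self [simp]: "a + a = (0::bit)"
  by (metis add_0 add_0_right bit_not_one_iff bit_2_eq_0 one_add_one)

lemma bit_add_eq_0_iff: "a + b = 0 \<longleftrightarrow> a = (b::bit)"
  by (cases "a = 0"; cases "b = 0") simp_all

lemma vec_add_self [simp]: "v + v = (0 :: nat \<Rightarrow> bit)"
  by (rule ext) simp

lemma vec_add_eq_0_iff: "v + w = 0 \<longleftrightarrow> v = (w :: nat \<Rightarrow> bit)"
  by (metis add_left_cancel vec_add_self)

text \<open>The common part is counted twice and vanishes in characteristic 2.\<close>

lemma sum_sym_diff: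
  fixes f :: "'a \<Rightarrow> nat \<Rightarrow> bit"
  assumes "finite A" "finite B"
  shows "sum f (sym_diff A B) = sum f A + sum f B"
proof -
  have "sum f A = sum f (A - B) + sum f (A \<inter> B)" "sum f B = sum f (B - A) + sum f (A \<inter> B)"
    using assms by (metis sum.Int_Diff add.commute Int_commute)+
  then have "sum f A + sum f B = sum f (A - B) + sum f (B - A) + (sum f (A \<inter> B) + sum f (A \<inter> B))"
    by (simp only: ac_simps)
  also have "\<dots> = sum f (sym_diff A B)"
    using assms by (subst sum.union_disjoint) auto
  finally show ?thesis ..
qed

lemma sum_in_Z2n: "(\<And>a. a \<in> A \<Longrightarrow> f a \<in> Z2n n) \<Longrightarrow> sum f A \<in> Z2n n"
  by (simp add: Z2n_def sum_fun_apply)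

lemma card_Z2n: "card (Z2n n) = 2 ^ n"
proof -
  have "bij_betw (\<lambda>v. {i. v i = 1}) (Z2n n) (Pow {..<n})"
  proof (rule bij_betw_byWitness[where f' = "\<lambda>I i. of_bool (i \<in> I)"])
    show "\<forall>v\<in>Z2n n. (\<lambda>i. of_bool (i \<in> {i. v i = 1})) = v"
      by (auto simp: fun_eq_iff of_bool_def)
    show "(\<lambda>v. {i. v i = 1}) ` Z2n n \<subseteq> Pow {..<n}"
      by (auto simp: Z2n_def not_le[symmetric])
    show "(\<lambda>I i. of_bool (i \<in> I)) ` Pow {..<n} \<subseteq> Z2n n"
      by (auto simp: Z2n_def)
  qed (auto simp: of_bool_def)
  then show ?thesis
    by (simp add: bij_betw_same_card card_Pow)
qed

text \<open>A double count with the characters \<open>Y \<mapsto> (-1) ^ card (Y \<inter> A)\<close> for \<open>A \<in> F\<close>: they are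
  orthogonal over \<open>Pow X\<close>, and all of them take the value \<open>1\<close> on \<open>F\<close>.\<close>

lemma card_even_intersections:
  assumes X: "finite X" and F: "F \<subseteq> Pow X"
    and even: "\<And>A B. A \<in> F \<Longrightarrow> B \<in> F \<Longrightarrow> even (card (A \<inter> B))"
  shows "(card F)\<^sup>2 \<le> 2 ^ card X"
proof -
  define \<chi> :: "'a set \<Rightarrow> 'a \<Rightarrow> int" where "\<chi> A i = (if i \<in> A then - 1 else 1)" for A i
  have finF: "finite F"
    using F X by (simp add: finite_subset)
  have orth: "(\<Sum>Y\<in>Pow X. (\<Prod>i\<in>Y. \<chi> A i) * (\<Prod>i\<in>Y. \<chi> B i)) = (if A = B then 2 ^ card X else 0)"
    if "A \<in> F" "B \<in> F" for A B
  proof -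
    \<comment> \<open>The padding factor 1 brings the sum into the shape of \<open>prod_add\<close>,
      which factors it over the points of \<open>X\<close>.\<close>
    have "(\<Sum>Y\<in>Pow X. (\<Prod>i\<in>Y. \<chi> A i) * (\<Prod>i\<in>Y. \<chi> B i))
        = (\<Sum>Y\<in>Pow X. (\<Prod>i\<in>Y. \<chi> A i * \<chi> B i) * (\<Prod>i\<in>X - Y. 1))"
      by (simp add: prod.distrib)
    also have "\<dots> = (\<Prod>i\<in>X. \<chi> A i * \<chi> B i + 1)"
      by (rule prod_add[symmetric]) fact
    also have "\<dots> = (if A = B then 2 ^ card X else 0)"
    proof (cases "A = B")
      case True
      have "\<chi> B i * \<chi> B i + 1 = 2" for i
        by (simp add: \<chi>_def)
      with True show ?thesis
        by simp
    next
      case False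
      moreover have "A \<subseteq> X" "B \<subseteq> X"
        using F that by auto
      \<comment> \<open>A point in exactly one of \<open>A\<close> and \<open>B\<close> contributes
        the factor -1 + 1 = 0.\<close>
      ultimately obtain i where "i \<in> X" "(i \<in> A) \<noteq> (i \<in> B)"
        by blast
      then have "\<exists>i\<in>X. \<chi> A i * \<chi> B i + 1 = 0"
        by (intro bexI[of _ i]) (auto simp: \<chi>_def)
      with False show ?thesis
        by (simp add: X)
    qed
    finally show ?thesis .
  qed
  have one: "(\<Prod>i\<in>Y. \<chi> A i) = 1" if "A \<in> F" "Y \<in> F" for A Y
  proof -
    have "finite Y"
      using F X that by (auto intro: finite_subset)
    then have "(\<Prod>i\<in>Y. \<chi> A i) = (\<Prod>i\<in>Y \<inter> A. - 1)"
      unfolding \<chi>_def by (rule prod.inter_restrict[symmetric])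
    also have "\<dots> = 1"
      using even[OF that(2,1)] by simp
    finally show ?thesis .
  qed
  \<comment> \<open>On \<open>F\<close> each character sum equals \<open>card F\<close>, whence the
    cube; passing to \<open>Pow X\<close> only adds squares.\<close>
  have "int (card F) * (int (card F))\<^sup>2 = (\<Sum>Y\<in>F. (\<Sum>A\<in>F. \<Prod>i\<in>Y. \<chi> A i)\<^sup>2)"
    by (simp add: one)
  also have "\<dots> \<le> (\<Sum>Y\<in>Pow X. (\<Sum>A\<in>F. \<Prod>i\<in>Y. \<chi> A i)\<^sup>2)"
    using X F by (intro sum_mono2) auto
  also have "\<dots> = (\<Sum>Y\<in>Pow X. \<Sum>A\<in>F. \<Sum>B\<in>F. (\<Prod>i\<in>Y. \<chi> A i) * (\<Prod>i\<in>Y. \<chi> B i))"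
    by (simp add: power2_eq_square sum_product)
  also have "\<dots> = (\<Sum>A\<in>F. \<Sum>Y\<in>Pow X. \<Sum>B\<in>F. (\<Prod>i\<in>Y. \<chi> A i) * (\<Prod>i\<in>Y. \<chi> B i))"
    by (rule sum.swap)
  also have "\<dots> = (\<Sum>A\<in>F. \<Sum>B\<in>F. \<Sum>Y\<in>Pow X. (\<Prod>i\<in>Y. \<chi> A i) * (\<Prod>i\<in>Y. \<chi> B i))"
    by (intro sum.cong refl sum.swap)
  also have "\<dots> = int (card F) * 2 ^ card X"
    by (simp add: orth finF)
  finally have "int (card F * (card F)\<^sup>2) \<le> int (card F * 2 ^ card X)"
    by simp
  then have "card F * (card F)\<^sup>2 \<le> card F * 2 ^ card X"
    by (simp only: of_nat_le_iff)
  then show ?thesis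
    by (cases "card F = 0") auto
qed

text \<open>Since \<open>A\<close> and \<open>B\<close> sum to 0, the disjoint sets
  \<open>A \<inter> B\<close>, \<open>A - B\<close>, \<open>B - A\<close> have equal sums. At most
  one of them has odd size, and the claim is checked in each case.\<close>

lemma theta_property_relations:
  fixes S :: "(nat \<Rightarrow> bit) set"
  assumes S: "theta_property S" "finite S"
    and A: "A \<subseteq> S" "\<Sum>A = 0" and B: "B \<subseteq> S" "\<Sum>B = 0"
  shows "even (card (A \<inter> B)) \<longleftrightarrow> even (card A * card B)"
proof -
  have fin: "finite A" "finite B"
    using S A B finite_subset by blast+
  have "\<Sum>(A \<inter> B) + \<Sum>(A - B) = 0" "\<Sum>(A \<inter> B) + \<Sum>(B - A) = 0"
    using A B fin by (metis sum.Int_Diff Int_commute)+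
  then have "\<Sum>(A \<inter> B) = \<Sum>(A - B)" "\<Sum>(A - B) = \<Sum>(B - A)"
    by (simp_all add: vec_add_eq_0_iff)
  moreover have "A \<inter> B \<inter> (A - B) = {}" "A \<inter> B \<inter> (B - A) = {}" "(A - B) \<inter> (B - A) = {}"
    "A \<inter> B \<subseteq> S" "A - B \<subseteq> S" "B - A \<subseteq> S"
    using A B by auto
  ultimately have "(even (card (A \<inter> B)) \<and> even (card (A - B))) \<or>
      (even (card (A \<inter> B)) \<and> even (card (B - A))) \<or> (even (card (A - B)) \<and> even (card (B - A)))"
    using S(1)[unfolded theta_property_def, rule_format, of "A \<inter> B" "A - B" "B - A"] by simp
  moreover have "card A = card (A \<inter> B) + card (A - B)" "card B = card (A \<inter> B) + card (B - A)"
    using fin by (metis card_Int_Diff Int_commute)+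
  ultimately show ?thesis
    by auto
qed

text \<open>Taking element sums splits \<open>Pow S\<close> into at most \<open>2 ^ n\<close>
  fibres, none larger than the fibre \<open>K\<close> over 0. Self-orthogonality bounds the square
  of \<open>card K\<close> by \<open>2 ^ (card S + 1)\<close>; squaring the first estimate and
  comparing exponents gives the bound.\<close>

lemma card_theta_property_le:
  assumes SZ: "S \<subseteq> Z2n n" and S: "theta_property S"
  shows "card S \<le> 2 * n + 1"
proof -
  have finS: "finite S"
    using SZ finite_Z2n finite_subset by blast
  define K where "K = {A. A \<subseteq> S \<and> \<Sum>A = 0}"
  have finK: "finite K"
    unfolding K_def using finS by simp
  \<comment> \<open>Symmetric difference with one fixed member maps a fibre injectively into
    \<open>K\<close>, because the two sums \<open>v\<close> cancel.\<close>
  have fibre: "card {A. A \<subseteq> S \<and> \<Sum>A = v} \<le> card K" for v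
  proof (cases "\<exists>B. B \<subseteq> S \<and> \<Sum>B = v")
    case True
    then obtain B where B: "B \<subseteq> S" "\<Sum>B = v"
      by blast
    have "inj_on (\<lambda>A. sym_diff A B) {A. A \<subseteq> S \<and> \<Sum>A = v}"
      by (rule inj_onI) blast
    moreover have "(\<lambda>A. sym_diff A B) ` {A. A \<subseteq> S \<and> \<Sum>A = v} \<subseteq> K"
    proof
      fix C assume "C \<in> (\<lambda>A. sym_diff A B) ` {A. A \<subseteq> S \<and> \<Sum>A = v}"
      then obtain A where A: "A \<subseteq> S" "\<Sum>A = v" and C: "C = sym_diff A B"
        by blast
      have "\<Sum>C = \<Sum>A + \<Sum>B"
        unfolding C using A(1) B(1) finS by (intro sum_sym_diff) (auto intro: finite_subset)
      with A B C show "C \<in> K"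
        by (auto simp: K_def)
    qed
    ultimately show ?thesis
      using finK by (meson card_inj_on_le)
  next
    case False
    then have "{A. A \<subseteq> S \<and> \<Sum>A = v} = {}"
      by blast
    then show ?thesis
      by (metis card.empty le0)
  qed
  have "\<Sum>A \<in> Z2n n" if "A \<subseteq> S" for A
    using that SZ by (intro sum_in_Z2n) auto
  then have "Pow S = (\<Union>v\<in>Z2n n. {A. A \<subseteq> S \<and> \<Sum>A = v})"
    by auto
  then have "2 ^ card S = card (\<Union>v\<in>Z2n n. {A. A \<subseteq> S \<and> \<Sum>A = v})"
    using finS by (metis card_Pow)
  also have "\<dots> \<le> (\<Sum>v\<in>Z2n n. card {A. A \<subseteq> S \<and> \<Sum>A = v})"
    by (rule card_UN_le[OF finite_Z2n])
  also have "\<dots> \<le> (\<Sum>v\<in>Z2n n. card K)"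
    by (intro sum_mono fibre)
  finally have "2 ^ card S \<le> 2 ^ n * card K"
    by (simp add: card_Z2n)
  then have "(2 ^ card S)\<^sup>2 \<le> (2 ^ n * card K)\<^sup>2"
    by (rule power_mono) simp
  also have "\<dots> = (2 ^ n)\<^sup>2 * (card K)\<^sup>2"
    by (rule power_mult_distrib)
  also have "(card K)\<^sup>2 \<le> 2 ^ (card S + 1)"
  proof -
    text \<open>A parity coordinate \<open>None\<close> makes all intersections even.\<close>
    define enc where "enc A = Some ` A \<union> (if odd (card A) then {None} else {})"
      for A :: "(nat \<Rightarrow> bit) set"
    have "inj_on enc K"
      by (rule inj_onI) (auto simp: enc_def split: if_splits)
    then have "card K = card (enc ` K)"
      by (rule card_image[symmetric])
    moreover have "(card (enc ` K))\<^sup>2 \<le> 2 ^ card (insert None (Some ` S))"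
    proof (rule card_even_intersections)
      show "enc ` K \<subseteq> Pow (insert None (Some ` S))"
        by (auto simp: enc_def K_def split: if_splits)
      fix C D assume "C \<in> enc ` K" "D \<in> enc ` K"
      then obtain A B where AB: "A \<in> K" "B \<in> K" and CD: "C = enc A" "D = enc B"
        by blast
      \<comment> \<open>\<open>None\<close> is common to both exactly when \<open>card A\<close> and
        \<open>card B\<close> are odd, which is when \<open>A \<inter> B\<close> has odd
        size.\<close>
      have "C \<inter> D = Some ` (A \<inter> B) \<union> (if odd (card A * card B) then {None} else {})"
        by (auto simp: CD enc_def)
      moreover have "finite (A \<inter> B)"
        using AB finS by (auto simp: K_def intro: finite_subset)
      ultimately have "card (C \<inter> D) = card (A \<inter> B) + (if odd (card A * card B) then 1 else 0)"
        by (simp add: card_image)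
      then show "even (card (C \<inter> D))"
        using theta_property_relations[OF S finS, of A B] AB by (auto simp: K_def)
    qed (use finS in simp)
    moreover have "card (insert None (Some ` S)) = card S + 1"
      using finS by (subst card_insert_disjoint) (auto simp: card_image)
    ultimately show ?thesis
      by simp
  qed
  finally have "(2::nat) ^ (card S * 2) \<le> 2 ^ (n * 2 + (card S + 1))"
    by (simp only: power_mult power_add mult_le_mono2 power2_eq_square)
  then have "card S * 2 \<le> n * 2 + (card S + 1)"
    by (subst (asm) power_increasing_iff) auto
  then show ?thesis
    by simp
qed

section \<open>Building up self-dual families\<close>

text \<open>The \<open>2 * n + 1\<close> vectors together with \<open>0\<close>, each with an additional coordinate \<open>1\<close>, are the
  columns of a parity check matrix of a self-dual code.\<close>

definition theta_family :: "nat \<Rightarrow> (nat \<Rightarrow> nat \<Rightarrow> bit) \<Rightarrow> bool" where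
  "theta_family n t \<longleftrightarrow>
    (\<forall>j\<le>2 * n. t j \<in> Z2n n) \<and>
    (\<forall>i. (\<Sum>j\<le>2 * n. t j i) = 0) \<and>
    (\<forall>v\<in>Z2n n. \<exists>c. \<forall>i. v i = (\<Sum>j\<le>2 * n. c j * t j i)) \<and>
    (\<forall>c d. (\<forall>i. (\<Sum>j\<le>2 * n. c j * t j i) = 0) \<and> (\<forall>i. (\<Sum>j\<le>2 * n. d j * t j i) = 0) \<longrightarrow>
      (\<Sum>j\<le>2 * n. c j * d j) = (\<Sum>j\<le>2 * n. c j) * (\<Sum>j\<le>2 * n. d j))"

text \<open>The parity coordinate makes all weights even, so this is minimum distance at least 6 for
  the code. Sizes 1 and 2 are covered too: no vector is 0 and no two coincide.\<close>

definition no_short_relation :: "nat \<Rightarrow> (nat \<Rightarrow> nat \<Rightarrow> bit) \<Rightarrow> bool" where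
  "no_short_relation n t \<longleftrightarrow> (\<forall>J\<subseteq>{..2 * n}. J \<noteq> {} \<and> sum t J = 0 \<longrightarrow> 5 \<le> card J)"

definition combination :: "nat \<Rightarrow> (nat \<Rightarrow> bit) \<Rightarrow> (nat \<Rightarrow> nat \<Rightarrow> bit) \<Rightarrow> nat \<Rightarrow> bit" where
  "combination n x t = (\<lambda>i. \<Sum>j\<le>2 * n. x j * t j i)"

text \<open>The building-up construction of self-dual codes; \<open>w\<close> is the vector \<open>combination n x t\<close>, and the
  new coordinate is put first.\<close>

definition extend :: "nat \<Rightarrow> (nat \<Rightarrow> bit) \<Rightarrow> (nat \<Rightarrow> nat \<Rightarrow> bit) \<Rightarrow> nat \<Rightarrow> nat \<Rightarrow> bit" where
  "extend n x t j =
    (if j \<le> 2 * n then case_nat (x j) (t j)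
     else case_nat (of_bool (j = 2 * n + 2)) (combination n x t))"

lemma theta_family_cong:
  assumes "\<And>j. j \<le> 2 * n \<Longrightarrow> t j = u j"
  shows "theta_family n t \<longleftrightarrow> theta_family n u"
proof -
  have *: "(\<Sum>j\<le>2 * n. t j i) = (\<Sum>j\<le>2 * n. u j i)"
    "(\<Sum>j\<le>2 * n. c j * t j i) = (\<Sum>j\<le>2 * n. c j * u j i)" for i c
    by (auto intro!: sum.cong simp: assms)
  have "(\<forall>j\<le>2 * n. t j \<in> Z2n n) \<longleftrightarrow> (\<forall>j\<le>2 * n. u j \<in> Z2n n)"
    using assms by auto
  then show ?thesis
    unfolding theta_family_def by (simp only: *)
qed

lemma theta_familyD:
  assumes "theta_family n t"
  shows "j \<le> 2 * n \<Longrightarrow> t j \<in> Z2n n"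
    and "(\<Sum>j\<le>2 * n. t j i) = 0"
    and "v \<in> Z2n n \<Longrightarrow> \<exists>c. combination n c t = v"
    and "combination n c t = 0 \<Longrightarrow> combination n d t = 0 \<Longrightarrow>
      (\<Sum>j\<le>2 * n. c j * d j) = (\<Sum>j\<le>2 * n. c j) * (\<Sum>j\<le>2 * n. d j)"
proof -
  show "j \<le> 2 * n \<Longrightarrow> t j \<in> Z2n n" "(\<Sum>j\<le>2 * n. t j i) = 0"
    using assms by (simp_all add: theta_family_def)
  show "\<exists>c. combination n c t = v" if v: "v \<in> Z2n n"
  proof -
    obtain c where "\<forall>i. v i = (\<Sum>j\<le>2 * n. c j * t j i)"
      using assms v unfolding theta_family_def by blast
    then show ?thesis
      by (intro exI[of _ c]) (simp add: combination_def fun_eq_iff)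
  qed
  show "(\<Sum>j\<le>2 * n. c j * d j) = (\<Sum>j\<le>2 * n. c j) * (\<Sum>j\<le>2 * n. d j)"
    if "combination n c t = 0" "combination n d t = 0"
  proof -
    have "\<forall>i. (\<Sum>j\<le>2 * n. c j * t j i) = 0" "\<forall>i. (\<Sum>j\<le>2 * n. d j * t j i) = 0"
      using that by (simp_all add: combination_def fun_eq_iff)
    then show ?thesis
      using assms unfolding theta_family_def by blast
  qed
qed

lemma combination_indicator:
  assumes "J \<subseteq> {..2 * n}"
  shows "combination n (\<lambda>j. of_bool (j \<in> J)) t = sum t J"
proof
  fix i
  have "sum t J i = (\<Sum>j\<in>{..2 * n} \<inter> J. t j i)"
    using assms by (simp add: sum_fun_apply Int_absorb1)
  also have "\<dots> = (\<Sum>j\<le>2 * n. if j \<in> J then t j i else 0)"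
    by (rule sum.inter_restrict) simp
  also have "\<dots> = (\<Sum>j\<le>2 * n. of_bool (j \<in> J) * t j i)"
    by (intro sum.cong) auto
  finally show "combination n (\<lambda>j. of_bool (j \<in> J)) t i = sum t J i"
    by (simp add: combination_def)
qed

text \<open>Start of the construction: the one vector of dimension 0, corresponding to the self-dual
  code of length 2.\<close>

lemma theta_family_0: "theta_family 0 (\<lambda>_. 0)"
  by (simp add: theta_family_def Z2n_def)

lemma sum_extend: "(\<Sum>j\<le>2 * Suc n. f j) = (\<Sum>j\<le>2 * n. f j) + f (2 * n + 1) + f (2 * n + 2)"
  for f :: "nat \<Rightarrow> bit"
  by simp

text \<open>Both new vectors are \<open>combination n x t\<close> behind the new coordinate, so
  outside that coordinate they can be folded back into the old coefficients as multiples of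
  \<open>x\<close>. Relations of the new family thus become relations of the old one.\<close>

lemma combination_extend:
  "combination (Suc n) c (extend n x t) 0 = (\<Sum>j\<le>2 * n. c j * x j) + c (2 * n + 2)"
  "combination (Suc n) c (extend n x t) (Suc i) =
     combination n (\<lambda>j. c j + (c (2 * n + 1) + c (2 * n + 2)) * x j) t i"
  unfolding combination_def sum_extend
  by (simp_all add: extend_def combination_def sum.distrib distrib_right sum_distrib_left mult.assoc
      add.assoc)

text \<open>Bilinearity is pulled back: new relations \<open>c\<close>, \<open>c'\<close> give old
  relations \<open>c + d * x\<close>, \<open>c' + d' * x\<close>, and coordinate 0 determines the
  inner products of \<open>c\<close> and \<open>c'\<close> with \<open>x\<close>. The odd sum of
  \<open>x\<close> makes the remaining terms match.\<close>

lemma theta_family_extend: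
  assumes t: "theta_family n t" and x: "(\<Sum>j\<le>2 * n. x j) = 1"
  shows "theta_family (Suc n) (extend n x t)"
  unfolding theta_family_def
proof (intro conjI allI impI ballI)
  note Z = theta_familyD(1)[OF t] and sum0 = theta_familyD(2)[OF t]
    and span = theta_familyD(3)[OF t] and bil = theta_familyD(4)[OF t]
  have "combination n x t \<in> Z2n n"
    using Z by (auto simp: Z2n_def combination_def)
  then show "extend n x t j \<in> Z2n (Suc n)" for j
    using Z by (auto simp: Z2n_def extend_def split: nat.split)
  show "(\<Sum>j\<le>2 * Suc n. extend n x t j i) = 0" for i
    unfolding sum_extend by (cases i) (simp_all add: extend_def x sum0 add.assoc)
  show "\<exists>c. \<forall>i. v i = (\<Sum>j\<le>2 * Suc n. c j * extend n x t j i)" if v: "v \<in> Z2n (Suc n)" for v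
  proof -
    have "(\<lambda>i. v (Suc i)) \<in> Z2n n"
      using v by (simp add: Z2n_def)
    then obtain c where c: "combination n c t = (\<lambda>i. v (Suc i))"
      using span by blast
    \<comment> \<open>With equal coefficients the two new vectors cancel except in coordinate 0,
      where their common coefficient supplies the missing amount.\<close>
    define d where "d j = (if j \<le> 2 * n then c j else v 0 + (\<Sum>j\<le>2 * n. c j * x j))" for j
    have "combination (Suc n) d (extend n x t) i = v i" for i
    proof (cases i)
      case 0
      have "(\<Sum>j\<le>2 * n. d j * x j) = (\<Sum>j\<le>2 * n. c j * x j)"
        by (intro sum.cong) (auto simp: d_def)
      then show ?thesis
        by (simp add: 0 combination_extend d_def add.left_commute)
    next
      case (Suc i)
      have "combination n (\<lambda>j. d j + (d (2 * n + 1) + d (2 * n + 2)) * x j) t = combination n c t"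
        by (auto simp: combination_def d_def fun_eq_iff intro!: sum.cong)
      then show ?thesis
        using c by (simp add: Suc combination_extend fun_eq_iff)
    qed
    then have "\<forall>i. v i = combination (Suc n) d (extend n x t) i"
      by metis
    then show ?thesis
      unfolding combination_def by (intro exI[of _ d])
  qed
  fix c c'
  assume "(\<forall>i. (\<Sum>j\<le>2 * Suc n. c j * extend n x t j i) = 0) \<and>
    (\<forall>i. (\<Sum>j\<le>2 * Suc n. c' j * extend n x t j i) = 0)"
  then have zero: "combination (Suc n) c (extend n x t) i = 0"
      "combination (Suc n) c' (extend n x t) i = 0" for i
    unfolding combination_def by blast+
  define d where "d = c (2 * n + 1) + c (2 * n + 2)"
  define d' where "d' = c' (2 * n + 1) + c' (2 * n + 2)"
  have "combination n (\<lambda>j. c j + d * x j) t = 0" "combination n (\<lambda>j. c' j + d' * x j) t = 0"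
    using zero[of "Suc _"] by (simp_all add: combination_extend d_def d'_def fun_eq_iff)
  from bil[OF this]
  have "(\<Sum>j\<le>2 * n. (c j + d * x j) * (c' j + d' * x j))
      = ((\<Sum>j\<le>2 * n. c j) + d) * ((\<Sum>j\<le>2 * n. c' j) + d')"
    by (simp add: sum.distrib sum_distrib_left[symmetric] x)
  moreover have "(\<Sum>j\<le>2 * n. (c j + d * x j) * (c' j + d' * x j))
      = (\<Sum>j\<le>2 * n. c j * c' j) + d' * (\<Sum>j\<le>2 * n. c j * x j)
        + d * (\<Sum>j\<le>2 * n. c' j * x j) + d * d' * (\<Sum>j\<le>2 * n. x j)"
  proof -
    have "(c j + d * x j) * (c' j + d' * x j)
        = c j * c' j + d' * (c j * x j) + d * (c' j * x j) + d * d' * x j" for j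
      \<comment> \<open>The case split provides \<open>x j * x j = x j\<close>.\<close>
      by (cases "x j = 0") (simp_all add: algebra_simps)
    then show ?thesis
      by (simp add: sum.distrib sum_distrib_left)
  qed
  moreover have "(\<Sum>j\<le>2 * n. c j * x j) = c (2 * n + 2)" "(\<Sum>j\<le>2 * n. c' j * x j) = c' (2 * n + 2)"
    using zero[of 0] by (simp_all only: combination_extend bit_add_eq_0_iff)
  ultimately have "(\<Sum>j\<le>2 * n. c j * c' j) + d' * c (2 * n + 2) + d * c' (2 * n + 2) + d * d'
      = ((\<Sum>j\<le>2 * n. c j) + d) * ((\<Sum>j\<le>2 * n. c' j) + d')"
    by (simp add: x)
  \<comment> \<open>Here \<open>a\<close>, \<open>b\<close> and \<open>a'\<close>, \<open>b'\<close>
    stand for the coefficients of the two new vectors; mixed terms occur in pairs and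
    cancel.\<close>
  moreover have "\<And>s p q a b a' b' :: bit.
      s + (a' + b') * b + (a + b) * b' + (a + b) * (a' + b') = (p + (a + b)) * (q + (a' + b'))
      \<Longrightarrow> s + a * a' + b * b' = (p + a + b) * (q + a' + b')"
  proof -
    fix s p q a b a' b' :: bit
    assume "s + (a' + b') * b + (a + b) * b' + (a + b) * (a' + b') = (p + (a + b)) * (q + (a' + b'))"
    moreover have "s + a * a' + b * b' = s + (a' + b') * b + (a + b) * b' + (a + b) * (a' + b')"
      by (cases "a = 0"; cases "b = 0"; cases "a' = 0"; cases "b' = 0") (simp_all add: add.assoc)
    ultimately show "s + a * a' + b * b' = (p + a + b) * (q + a' + b')"
      by (simp add: add.assoc)
  qed
  ultimately show "(\<Sum>j\<le>2 * Suc n. c j * c' j) = (\<Sum>j\<le>2 * Suc n. c j) * (\<Sum>j\<le>2 * Suc n. c' j)"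
    unfolding sum_extend d_def d'_def by blast
qed

text \<open>Split by the new indices in \<open>J\<close>. With none or both, the old part is a
  nonempty relation; with exactly one, the old part sums to \<open>combination n x t\<close> and has
  at least 4 members, so \<open>J\<close> has at least 5.\<close>

lemma no_short_relation_extend:
  assumes t: "no_short_relation n t"
    and w: "\<And>J. J \<subseteq> {..2 * n} \<Longrightarrow> sum t J = combination n x t \<Longrightarrow> 4 \<le> card J"
  shows "no_short_relation (Suc n) (extend n x t)"
  unfolding no_short_relation_def
proof (intro allI impI)
  fix J :: "nat set"
  assume J: "J \<subseteq> {..2 * Suc n}" and rel: "J \<noteq> {} \<and> sum (extend n x t) J = 0"
  define a b where "a = 2 * n + 1" and "b = 2 * n + 2"
  define I N where "I = J \<inter> {..2 * n}" and "N = J \<inter> {a, b}"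
  let ?w = "combination n x t"
  have fin: "finite I" "finite N" and I: "I \<subseteq> {..2 * n}"
    by (simp_all add: I_def N_def)
  have disj: "I \<inter> N = {}"
    by (auto simp: I_def N_def a_def b_def)
  have J_eq: "J = I \<union> N"
    using J by (auto simp: I_def N_def a_def b_def)
  have ab: "a \<noteq> b"
    by (simp add: a_def b_def)
  have card_J: "card J = card I + card N"
    unfolding J_eq by (rule card_Un_disjoint[OF fin disj])
  have new: "extend n x t a (Suc i) = ?w i" "extend n x t b (Suc i) = ?w i"
    "extend n x t a 0 = 0" "extend n x t b 0 = 1" for i
    by (simp_all add: extend_def a_def b_def)
  have zero: "sum t I i + (\<Sum>j\<in>N. extend n x t j (Suc i)) = 0" for i
  proof -
    have "sum t I i = (\<Sum>j\<in>I. extend n x t j (Suc i))"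
      unfolding sum_fun_apply by (intro sum.cong) (auto simp: I_def extend_def)
    moreover have "sum (extend n x t) J (Suc i) = 0"
      using rel by simp
    ultimately show ?thesis
      unfolding J_eq sum_fun_apply by (simp only: sum.union_disjoint[OF fin disj])
  qed
  consider "N = {}" | "N = {a, b}" | "N = {a}" | "N = {b}"
    unfolding N_def by blast
  then show "5 \<le> card J"
  proof cases
    case 1
    have "sum t I = 0"
      using zero by (simp add: 1 fun_eq_iff)
    then show ?thesis
      using rel t I card_J J_eq by (simp add: 1 no_short_relation_def)
  next
    case 2
    have "sum t I = 0"
      using zero ab by (simp add: 2 new fun_eq_iff)
    moreover have "I \<noteq> {}"
    proof
      assume "I = {}"
      then have "sum (extend n x t) J 0 = 1"
        using ab by (simp add: J_eq 2 new)
      with rel show False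
        by simp
    qed
    ultimately show ?thesis
      using t I card_J by (simp add: no_short_relation_def trans_le_add1)
  next
    case 3
    have "sum t I + ?w = 0"
      using zero by (simp add: 3 new fun_eq_iff)
    then show ?thesis
      using w[OF I] by (simp add: 3 card_J vec_add_eq_0_iff)
  next
    case 4
    have "sum t I + ?w = 0"
      using zero by (simp add: 4 new fun_eq_iff)
    then show ?thesis
      using w[OF I] by (simp add: 4 card_J vec_add_eq_0_iff)
  qed
qed

text \<open>The family sums to 0, so adding 1 to every coefficient keeps the combination; as
  \<open>2 * n + 1\<close> is odd, it flips the coefficient sum.\<close>

lemma odd_combination_exists:
  assumes t: "theta_family n t" and w: "w \<in> Z2n n"
  shows "\<exists>x. (\<Sum>j\<le>2 * n. x j) = 1 \<and> combination n x t = w"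
proof -
  obtain c where c: "combination n c t = w"
    using theta_familyD(3)[OF t w] by blast
  show ?thesis
  proof (cases "(\<Sum>j\<le>2 * n. c j) = 0")
    case True
    have "of_nat (2 * n + 1) = (1::bit)"
      by simp
    then have "(\<Sum>j\<le>2 * n. c j + 1) = 1"
      using True by (simp add: sum.distrib)
    moreover have "combination n (\<lambda>j. c j + 1) t = combination n c t"
      by (simp add: combination_def theta_familyD(2)[OF t] distrib_right sum.distrib)
    ultimately show ?thesis
      using c by blast
  next
    case False
    with c show ?thesis
      by auto
  qed
qed

section \<open>Existence of an extension vector by counting\<close>

lemma card_small_subsets:
  assumes "finite A"
  shows "card {J. J \<subseteq> A \<and> card J \<le> k} = (\<Sum>i\<le>k. card A choose i)"
proof -
  have "{J. J \<subseteq> A \<and> card J \<le> k} = (\<Union>i\<le>k. {J. J \<subseteq> A \<and> card J = i})"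
    by auto
  also have "card \<dots> = (\<Sum>i\<le>k. card {J. J \<subseteq> A \<and> card J = i})"
    using assms by (intro card_UN_disjoint) auto
  finally show ?thesis
    using assms by (simp add: n_subsets)
qed

text \<open>The factor 2, like the 6 in the cubic case, avoids division. By Pascal's rule this sum
  is the increment in the cubic case.\<close>

lemma sum_choose_atMost_2: "2 * (\<Sum>i\<le>2. n choose i) = n ^ 2 + n + 2"
  by (induction n) (simp_all add: numeral_2_eq_2)

lemma sum_choose_atMost_3: "6 * (\<Sum>i\<le>3. n choose i) = n ^ 3 + 5 * n + 6"
proof (induction n)
  case 0
  show ?case by (simp add: eval_nat_numeral)
next
  case (Suc n)
  have "(\<Sum>i\<le>3. Suc n choose i) = (\<Sum>i\<le>3. n choose i) + (\<Sum>i\<le>2. n choose i)"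
    by (simp add: eval_nat_numeral)
  then show ?case
    using Suc sum_choose_atMost_2[of n] by (simp add: power2_eq_square power3_eq_cube algebra_simps)
qed

text \<open>At \<open>n = 11\<close> both sides equal 2048, so the strict inequality starts at 12.
  From there the cubic at most doubles in each step.\<close>

lemma sum_binomial_less_power:
  assumes "12 \<le> n"
  shows "(\<Sum>i\<le>3. (2 * n + 1) choose i) < 2 ^ n"
proof -
  have "(2 * n + 1) ^ 3 + 5 * (2 * n + 1) + 6 < 6 * 2 ^ n"
    using assms
  proof (induction n rule: dec_induct)
    case base
    show ?case by simp
  next
    case (step n)
    have "12 * n \<le> n * n"
      using step(1) by simp
    moreover have "12 * (n * n) \<le> n * (n * n)"
      using step(1) by (intro mult_right_mono) simp_all
    moreover have "(2 * Suc n + 1) ^ 3 = 8 * (n * (n * n)) + 36 * (n * n) + 54 * n + 27"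
      "(2 * n + 1) ^ 3 = 8 * (n * (n * n)) + 12 * (n * n) + 6 * n + 1"
      by (simp_all add: power3_eq_cube algebra_simps)
    \<comment> \<open>Naming the powers \<open>p\<close>, \<open>q\<close> and the cubes
      \<open>a\<close>, \<open>b\<close> leaves a linear problem.\<close>
    moreover have "a + 5 * (2 * Suc n + 1) + 6 \<le> 2 * (b + 5 * (2 * n + 1) + 6)"
      if "12 * n \<le> p" "12 * p \<le> q" "a = 8 * q + 36 * p + 54 * n + 27" "b = 8 * q + 12 * p + 6 * n + 1"
      for a b p q
      using that step(1) by simp
    ultimately have "(2 * Suc n + 1) ^ 3 + 5 * (2 * Suc n + 1) + 6
        \<le> 2 * ((2 * n + 1) ^ 3 + 5 * (2 * n + 1) + 6)"
      by blast
    with step(3) show ?case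
      by simp
  qed
  then show ?thesis
    using sum_choose_atMost_3[of "2 * n + 1"] by linarith
qed

text \<open>Pigeonhole: otherwise the sums over index sets of size at most 3 would cover
  \<open>Z2n n\<close>.\<close>

lemma extension_vector_exists:
  assumes "12 \<le> n"
  shows "\<exists>w\<in>Z2n n. \<forall>J\<subseteq>{..2 * n}. sum t J = w \<longrightarrow> 4 \<le> card J"
proof (rule ccontr)
  assume neg: "\<not> ?thesis"
  let ?F = "{J. J \<subseteq> {..2 * n} \<and> card J \<le> 3}"
  have "Z2n n \<subseteq> sum t ` ?F"
  proof
    fix w assume "w \<in> Z2n n"
    then obtain J where "J \<subseteq> {..2 * n}" "sum t J = w" "\<not> 4 \<le> card J"
      using neg by blast
    then show "w \<in> sum t ` ?F"
      by auto
  qed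
  moreover have finF: "finite ?F"
    by simp
  ultimately have "card (Z2n n) \<le> card ?F"
    by (meson card_image_le card_mono finite_imageI le_trans)
  then show False
    using sum_binomial_less_power[OF assms] by (simp add: card_Z2n card_small_subsets)
qed

lemma theta_family_step:
  assumes "12 \<le> n" "theta_family n t" "no_short_relation n t"
  shows "\<exists>t. theta_family (Suc n) t \<and> no_short_relation (Suc n) t"
proof -
  obtain w where w: "w \<in> Z2n n" "\<forall>J\<subseteq>{..2 * n}. sum t J = w \<longrightarrow> 4 \<le> card J"
    using extension_vector_exists assms by blast
  then obtain x where "(\<Sum>j\<le>2 * n. x j) = 1" "combination n x t = w"
    using odd_combination_exists assms by blast
  with w assms show ?thesis
    by (intro exI[of _ "extend n x t"] conjI theta_family_extend no_short_relation_extend) auto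
qed

section \<open>Explicit families for small dimensions\<close>

text \<open>Vectors as Boolean lists, with coordinate \<open>0\<close> at the head; missing entries are \<open>0\<close>.\<close>

fun vec_of :: "bool list \<Rightarrow> nat \<Rightarrow> bit" where
  "vec_of [] = 0"
| "vec_of (a # v) = case_nat (of_bool a) (vec_of v)"

text \<open>Keeping the longer tail agrees with reading missing entries as 0; in particular
  \<open>[]\<close> is a zero vector.\<close>

fun add_list :: "bool list \<Rightarrow> bool list \<Rightarrow> bool list" where
  "add_list [] w = w"
| "add_list v [] = v"
| "add_list (a # v) (b # w) = (a \<noteq> b) # add_list v w"

lemma vec_of_add_list: "vec_of (add_list v w) = vec_of v + vec_of w"
  by (induction v w rule: add_list.induct) (auto simp: fun_eq_iff split: nat.split)

lemma vec_of_eq_0_iff: "vec_of v = 0 \<longleftrightarrow> list_all Not v"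
proof (induction v)
  case (Cons a v)
  have "vec_of (a # v) = 0 \<longleftrightarrow> of_bool a = (0::bit) \<and> vec_of v = 0"
    by (auto simp: fun_eq_iff split: nat.split)
  then show ?case
    by (simp only: Cons list.pred_inject of_bool_eq_0_iff)
qed simp

text \<open>A branching search with remaining target \<open>v\<close> and at most \<open>k\<close>
  entries left to choose; in characteristic 2, choosing \<open>x\<close> changes the target by
  adding \<open>x\<close>.\<close>

fun subset_sum :: "nat \<Rightarrow> bool list \<Rightarrow> bool list list \<Rightarrow> bool" where
  "subset_sum 0 v L \<longleftrightarrow> list_all Not v"
| "subset_sum (Suc k) v [] \<longleftrightarrow> list_all Not v"
| "subset_sum (Suc k) v (x # L) \<longleftrightarrow> subset_sum (Suc k) v L \<or> subset_sum k (add_list x v) L"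

text \<open>\<open>x\<close> is the first member of the relation and \<open>k\<close> bounds the
  number of the others, so relations of up to \<open>k + 1\<close> members are found.\<close>

fun short_relation :: "nat \<Rightarrow> bool list list \<Rightarrow> bool" where
  "short_relation k [] \<longleftrightarrow> False"
| "short_relation k (x # L) \<longleftrightarrow> subset_sum k x L \<or> short_relation k L"

text \<open>Completeness lets a failed search exclude relations. Working with indices keeps equal
  list entries apart as summands.\<close>

lemma subset_sum_complete:
  assumes "J \<subseteq> set js" "card J \<le> k" "sum (vec_of \<circ> f) J = vec_of v"
  shows "subset_sum k v (map f js)"
  using assms
proof (induction k v "map f js" arbitrary: js J rule: subset_sum.induct)
  case (1 v)
  then have "J = {}"
    using finite_subset by fastforce
  with 1 show ?case
    by (metis subset_sum.simps(1) sum.empty vec_of_eq_0_iff)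
next
  case (2 k v)
  then have "J = {}"
    by simp
  with 2 show ?case
    by (metis subset_sum.simps(2) list.simps(8) sum.empty vec_of_eq_0_iff)
next
  case (3 k v x L)
  then obtain j js' where js: "js = j # js'" "x = f j" "L = map f js'"
    by auto
  have "subset_sum (Suc k) v L \<or> subset_sum k (add_list x v) L"
  proof (cases "j \<in> J")
    case True
    have fin: "finite J"
      using 3(4) finite_subset by blast
    have "vec_of x + sum (vec_of \<circ> f) (J - {j}) = vec_of v"
      using 3(6) sum.remove[OF fin True, of "vec_of \<circ> f"] by (simp add: js)
    then have "sum (vec_of \<circ> f) (J - {j}) = vec_of (add_list x v)"
      by (metis vec_of_add_list add.assoc add_0 vec_add_self)
    moreover have "J - {j} \<subseteq> set js'" "card (J - {j}) \<le> k"
      using 3(4,5) fin True by (auto simp: js)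
    ultimately show ?thesis
      using 3(2) js(3) by blast
  next
    case False
    then have "J \<subseteq> set js'"
      using 3(4) by (auto simp: js)
    then show ?thesis
      using 3(1) 3(5,6) js(3) by blast
  qed
  then show ?case
    by (simp flip: 3(3))
qed

text \<open>The first entry of \<open>js\<close> that lies in \<open>J\<close> carries a vector
  equal to the sum of the others, which \<open>subset_sum\<close> then finds.\<close>

lemma short_relation_complete:
  assumes "J \<subseteq> set js" "J \<noteq> {}" "card J \<le> Suc k" "sum (vec_of \<circ> f) J = 0"
  shows "short_relation k (map f js)"
  using assms
proof (induction js)
  case Nil
  then show ?case
    by simp
next
  case (Cons j js)
  show ?case
  proof (cases "j \<in> J")
    case True
    have fin: "finite J"
      using Cons(2) finite_subset by blast
    have "vec_of (f j) + sum (vec_of \<circ> f) (J - {j}) = 0"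
      using Cons(5) sum.remove[OF fin True, of "vec_of \<circ> f"] by (metis comp_apply)
    then have "sum (vec_of \<circ> f) (J - {j}) = vec_of (f j)"
      by (simp only: vec_add_eq_0_iff)
    moreover have "J - {j} \<subseteq> set js" "card (J - {j}) \<le> k"
      using Cons(2,4) fin True by auto
    ultimately show ?thesis
      by (simp add: subset_sum_complete)
  next
    case False
    with Cons show ?thesis
      by auto
  qed
qed

lemma no_short_relation_list:
  assumes "length L = 2 * n + 1" "\<not> short_relation 3 L"
  shows "no_short_relation n (\<lambda>j. vec_of (L ! j))"
  unfolding no_short_relation_def
proof (intro allI impI)
  fix J :: "nat set"
  assume J: "J \<subseteq> {..2 * n}" "J \<noteq> {} \<and> sum (\<lambda>j. vec_of (L ! j)) J = 0"
  have "short_relation 3 (map ((!) L) [0..<length L])" if "card J \<le> Suc 3"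
    using J that assms(1)
    by (intro short_relation_complete[of J]) (auto simp: comp_def less_Suc_eq_le)
  then show "5 \<le> card J"
    using assms(2) by (force simp: map_nth)
qed

text \<open>Executable counterpart of \<open>extend\<close>, where \<open>X\<close> lists the
  support of \<open>x\<close>.\<close>

definition extend_list :: "nat list \<Rightarrow> bool list list \<Rightarrow> bool list list" where
  "extend_list X L = (let w = foldr (\<lambda>j. add_list (L ! j)) X []
     in map (\<lambda>j. (j \<in> set X) # L ! j) [0..<length L] @ [False # w, True # w])"

lemma length_extend_list: "length (extend_list X L) = length L + 2"
  by (simp add: extend_list_def Let_def)

lemma theta_family_extend_list:
  assumes L: "length L = 2 * n + 1" "theta_family n (\<lambda>j. vec_of (L ! j))"
    and X: "distinct X" "odd (length X)" "set X \<subseteq> {..2 * n}"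
  shows "theta_family (Suc n) (\<lambda>j. vec_of (extend_list X L ! j))"
proof -
  let ?t = "\<lambda>j. vec_of (L ! j)" and ?x = "\<lambda>j. of_bool (j \<in> set X)"
  have "(\<Sum>j\<le>2 * n. ?x j) = (of_nat (length X) :: bit)"
    using X by (simp add: sum_of_bool_eq Int_absorb1 distinct_card)
  also have "\<dots> = 1"
    using X(2) by (auto elim!: oddE)
  finally have "theta_family (Suc n) (extend n ?x ?t)"
    by (rule theta_family_extend[OF L(2)])
  moreover have "vec_of (extend_list X L ! j) = extend n ?x ?t j" if j: "j \<le> 2 * Suc n" for j
  proof -
    have "vec_of (foldr (\<lambda>j. add_list (L ! j)) X []) = sum ?t (set X)"
      using X(1) by (induction X) (simp_all add: vec_of_add_list)
    then have w: "vec_of (foldr (\<lambda>j. add_list (L ! j)) X []) = combination n ?x ?t"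
      by (simp add: combination_indicator X(3))
    have "j \<le> 2 * n \<or> j = 2 * n + 1 \<or> j = 2 * n + 2"
      using j by (auto simp: le_Suc_eq)
    then consider "j \<le> 2 * n" | "j = 2 * n + 1" | "j = 2 * n + 2"
      by blast
    then show ?thesis
      by cases (simp_all add: extend_list_def Let_def extend_def nth_append L(1) w)
  qed
  ultimately show ?thesis
    using theta_family_cong[of "Suc n" "\<lambda>j. vec_of (extend_list X L ! j)" "extend n ?x ?t"] by simp
qed

text \<open>Collects the conditions of \<open>theta_family_extend_list\<close> on each index list;
  \<open>n\<close> is the dimension before the step.\<close>

fun valid_chain :: "nat \<Rightarrow> nat list list \<Rightarrow> bool" where
  "valid_chain n [] \<longleftrightarrow> True"
| "valid_chain n (X # Xs) \<longleftrightarrow>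
    distinct X \<and> odd (length X) \<and> list_all (\<lambda>j. j \<le> 2 * n) X \<and> valid_chain (Suc n) Xs"

lemma theta_family_chain:
  assumes "length L = 2 * n + 1" "theta_family n (\<lambda>j. vec_of (L ! j))" "valid_chain n Xs"
  shows "length (fold extend_list Xs L) = 2 * (n + length Xs) + 1 \<and>
    theta_family (n + length Xs) (\<lambda>j. vec_of (fold extend_list Xs L ! j))"
  using assms
proof (induction Xs arbitrary: n L)
  case (Cons X Xs)
  have "theta_family (Suc n) (\<lambda>j. vec_of (extend_list X L ! j))"
    using Cons.prems by (intro theta_family_extend_list) (auto simp: list_all_iff)
  then show ?case
    using Cons.IH[of "extend_list X L" "Suc n"] Cons.prems by (simp add: length_extend_list)
qed simp

text \<open>The first ten steps build the shortened binary Golay code of length 22, up to equivalence;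
  the last two were found by search.\<close>

definition chain :: "nat list list" where
  "chain = [[0], [0], [1, 2, 4], [2], [2, 5, 7], [1, 7, 9], [6, 9, 11], [8, 11, 13],
     [10, 13, 15], [6, 7, 12, 13, 14], [0, 1, 2, 3, 5], [0, 1, 2, 4, 10]]"

lemma theta_family_from_chain:
  assumes "k = length Xs" "valid_chain 0 Xs" "\<not> short_relation 3 (fold extend_list Xs [[]])"
  shows "\<exists>t. theta_family k t \<and> no_short_relation k t"
proof -
  \<comment> \<open>\<open>[[]]\<close> contains one vector without entries, the zero vector of
    dimension 0.\<close>
  have "theta_family 0 (\<lambda>j. vec_of ([[]] ! j))"
    by (subst theta_family_cong[of 0 _ "\<lambda>_. 0"]) (simp_all add: theta_family_0)
  then have "length (fold extend_list Xs [[]]) = 2 * k + 1"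
    "theta_family k (\<lambda>j. vec_of (fold extend_list Xs [[]] ! j))"
    using theta_family_chain[of "[[]]" 0 Xs] assms(1,2) by simp_all
  then show ?thesis
    using no_short_relation_list assms(3) by blast
qed

lemma theta_family_10_11_12:
  assumes "k \<in> {10, 11, 12}"
  shows "\<exists>t. theta_family k t \<and> no_short_relation k t"
proof (rule theta_family_from_chain)
  show "k = length (take k chain)" "valid_chain 0 (take k chain)"
    using assms by (auto simp: chain_def)
  \<comment> \<open>Short relations are excluded by evaluation at the end of each prefix only: the
    starting family contains 0 and hence has one.\<close>
  have "\<not> short_relation 3 (fold extend_list (take 10 chain) [[]])"
    by code_simp
  moreover have "\<not> short_relation 3 (fold extend_list (take 11 chain) [[]])"
    by code_simp
  moreover have "\<not> short_relation 3 (fold extend_list (take 12 chain) [[]])"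
    by code_simp
  ultimately show "\<not> short_relation 3 (fold extend_list (take k chain) [[]])"
    using assms by blast
qed

lemma theta_family_exists:
  assumes "10 \<le> n"
  shows "\<exists>t. theta_family n t \<and> no_short_relation n t"
proof (cases "n \<le> 12")
  case True
  then have "n \<in> {10, 11, 12}"
    using assms by auto
  then show ?thesis
    by (rule theta_family_10_11_12)
next
  case False
  then have "12 \<le> n"
    by simp
  then show ?thesis
  proof (induction n rule: dec_induct)
    case base
    show ?case
      by (rule theta_family_10_11_12) simp
  next
    case (step n)
    then show ?case
      using theta_family_step by blast
  qed
qed

section \<open>Sets of maximal size\<close>

context
  fixes n :: nat and t :: "nat \<Rightarrow> nat \<Rightarrow> bit"
  assumes t: "theta_family n t" "no_short_relation n t"
begin

lemma inj_on_family: "inj_on t {..2 * n}"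
proof (rule inj_onI)
  fix i j assume ij: "i \<in> {..2 * n}" "j \<in> {..2 * n}" "t i = t j"
  show "i = j"
  proof (rule ccontr)
    assume "i \<noteq> j"
    then have "sum t {i, j} = 0"
      using ij by simp
    then have "5 \<le> card {i, j}"
      using t(2) ij by (simp add: no_short_relation_def)
    then show False
      using \<open>i \<noteq> j\<close> by simp
  qed
qed

lemma family_subset:
  assumes "A \<subseteq> t ` {..2 * n}"
  obtains J where "J \<subseteq> {..2 * n}" "A = t ` J" "card A = card J" "\<Sum>A = sum t J"
proof -
  obtain J where J: "J \<subseteq> {..2 * n}" "A = t ` J"
    using assms by (meson subset_imageE)
  moreover from J have "inj_on t J"
    using inj_on_family inj_on_subset by blast
  ultimately show thesis
    using that by (simp add: card_image sum.reindex)
qed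

text \<open>If the pairs differ, equal sums force \<open>a\<close>, \<open>b\<close>,
  \<open>c\<close>, \<open>d\<close> to be distinct, giving a relation of size 4.\<close>

lemma sidon_family: "sidon (t ` {..2 * n})"
  unfolding sidon_def
proof (intro ballI impI)
  fix a b c d
  assume abcd: "a \<in> t ` {..2 * n}" "b \<in> t ` {..2 * n}" "c \<in> t ` {..2 * n}" "d \<in> t ` {..2 * n}"
    and eq: "a \<noteq> b \<and> c \<noteq> d \<and> a + b = c + d"
  show "{a, b} = {c, d}"
  proof (rule ccontr)
    assume neq: "{a, b} \<noteq> {c, d}"
    have "a \<noteq> b" "c \<noteq> d" "a \<noteq> c" "a \<noteq> d" "b \<noteq> c" "b \<noteq> d"
      using eq neq by (auto simp: add.commute)
    then have "\<Sum>{a, b, c, d} = (a + b) + (c + d)" and card: "card {a, b, c, d} = 4"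
      by (simp_all add: add.assoc)
    then have "\<Sum>{a, b, c, d} = 0"
      using eq by simp
    moreover have "{a, b, c, d} \<subseteq> t ` {..2 * n}"
      using abcd by simp
    then obtain J where J: "J \<subseteq> {..2 * n}" "card {a, b, c, d} = card J"
        "\<Sum>{a, b, c, d} = sum t J"
      by (rule family_subset)
    moreover from J(2) card have "J \<noteq> {}"
      by auto
    ultimately have "5 \<le> card J"
      using t(2) unfolding no_short_relation_def by metis
    with J(2) card show False
      by linarith
  qed
qed

text \<open>The bilinear condition of \<open>theta_family\<close> for indicator functions, whose
  inner product is \<open>card (I \<inter> J)\<close> modulo 2.\<close>

lemma relation_product:
  assumes I: "I \<subseteq> {..2 * n}" "sum t I = 0" and J: "J \<subseteq> {..2 * n}" "sum t J = 0"
  shows "even (card (I \<inter> J)) \<longleftrightarrow> even (card I * card J)"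
proof -
  have card: "(\<Sum>j\<le>2 * n. of_bool (j \<in> A)) = (of_nat (card A) :: bit)" if "A \<subseteq> {..2 * n}" for A
    using that by (simp add: sum_of_bool_eq Int_absorb1)
  have "(\<Sum>j\<le>2 * n. of_bool (j \<in> I) * of_bool (j \<in> J)) =
      (\<Sum>j\<le>2 * n. of_bool (j \<in> I)) * (\<Sum>j\<le>2 * n. of_bool (j \<in> J) :: bit)"
    using I J by (intro theta_familyD(4)[OF t(1)]) (simp_all add: combination_indicator)
  also have "(\<Sum>j\<le>2 * n. of_bool (j \<in> I) * of_bool (j \<in> J))
      = (\<Sum>j\<le>2 * n. of_bool (j \<in> I \<inter> J) :: bit)"
    by (intro sum.cong) auto
  finally have "(of_nat (card (I \<inter> J)) :: bit) = of_nat (card I * card J)"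
    by (simp only: card[OF I(1)] card[OF J(1)] card[OF le_infI1[OF I(1)]] of_nat_mult)
  moreover have "(of_nat m :: bit) = 0 \<longleftrightarrow> even m" for m
    by (metis even_of_nat even_zero bit_not_zero_iff odd_one)
  ultimately show ?thesis
    by metis
qed

text \<open>The unions of \<open>A\<close> with \<open>B\<close> and with \<open>C\<close> are
  relations meeting in \<open>A\<close>. For the sizes a, b, c this gives a = (a + b)(a + c), that
  is ab + ac + bc = 0 modulo 2, so at most one size is odd.\<close>

lemma theta_property_family: "theta_property (t ` {..2 * n})"
  unfolding theta_property_def
proof (intro allI impI)
  fix A B C
  assume *: "A \<subseteq> t ` {..2 * n} \<and> B \<subseteq> t ` {..2 * n} \<and> C \<subseteq> t ` {..2 * n} \<and>
    A \<inter> B = {} \<and> A \<inter> C = {} \<and> B \<inter> C = {} \<and> \<Sum>A = \<Sum>B \<and> \<Sum>B = \<Sum>C"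
  then have sub: "A \<subseteq> t ` {..2 * n}" "B \<subseteq> t ` {..2 * n}" "C \<subseteq> t ` {..2 * n}"
    by simp_all
  obtain I where I: "I \<subseteq> {..2 * n}" "A = t ` I" "card A = card I" "\<Sum>A = sum t I"
    by (rule family_subset[OF sub(1)])
  obtain J where J: "J \<subseteq> {..2 * n}" "B = t ` J" "card B = card J" "\<Sum>B = sum t J"
    by (rule family_subset[OF sub(2)])
  obtain K where K: "K \<subseteq> {..2 * n}" "C = t ` K" "card C = card K" "\<Sum>C = sum t K"
    by (rule family_subset[OF sub(3)])
  have disj: "I \<inter> J = {}" "I \<inter> K = {}" "J \<inter> K = {}"
    using * unfolding I(2) J(2) K(2) by auto
  have fin: "finite I" "finite J" "finite K"
    using I(1) J(1) K(1) by (simp_all add: finite_subset)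
  have "sum t (I \<union> J) = 0" "sum t (I \<union> K) = 0"
    using * by (simp_all add: sum.union_disjoint fin disj flip: I(4) J(4) K(4))
  then have "even (card ((I \<union> J) \<inter> (I \<union> K))) \<longleftrightarrow> even (card (I \<union> J) * card (I \<union> K))"
    using I(1) J(1) K(1) by (intro relation_product) simp_all
  moreover have "(I \<union> J) \<inter> (I \<union> K) = I"
    using disj by blast
  ultimately have "even (card I) \<longleftrightarrow> even ((card I + card J) * (card I + card K))"
    using disj fin by (simp add: card_Un_disjoint)
  then show "(even (card A) \<and> even (card B)) \<or> (even (card A) \<and> even (card C)) \<or>
      (even (card B) \<and> even (card C))"
    unfolding I(3) J(3) K(3) by auto
qed

lemma group_closure_family: "group_closure (t ` {..2 * n}) = Z2n n"
proof
  show "group_closure (t ` {..2 * n}) \<subseteq> Z2n n"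
  proof
    fix v assume "v \<in> group_closure (t ` {..2 * n})"
    then show "v \<in> Z2n n"
      by induction (use theta_familyD(1)[OF t(1)] in \<open>auto simp: Z2n_def\<close>)
  qed
  show "Z2n n \<subseteq> group_closure (t ` {..2 * n})"
  proof
    fix v assume "v \<in> Z2n n"
    then obtain c where c: "combination n c t = v"
      using theta_familyD(3)[OF t(1)] by blast
    \<comment> \<open>Coefficients in \<open>bit\<close> are indicators, so a combination is a sum
      over their support.\<close>
    define J where "J = {j. j \<le> 2 * n \<and> c j = 1}"
    have J: "J \<subseteq> {..2 * n}"
      by (auto simp: J_def)
    have "combination n (\<lambda>j. of_bool (j \<in> J)) t = v"
      unfolding c[symmetric] combination_def J_def
      by (intro ext sum.cong) (auto simp: of_bool_def)
    then have "v = sum t J"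
      using J by (simp add: combination_indicator)
    also have "\<dots> = \<Sum>(t ` J)"
      using inj_on_subset[OF inj_on_family J] by (simp add: sum.reindex)
    also have "\<dots> \<in> group_closure (t ` {..2 * n})"
      using J by (intro sum_in_group_closure) (auto intro: group_closure.base)
    finally show "v \<in> group_closure (t ` {..2 * n})" .
  qed
qed

end

lemma sidon_theta_set_exists:
  assumes "10 \<le> n"
  shows "\<exists>S. S \<in> generating_theta_sets n \<and> sidon S \<and> card S = 2 * n + 1"
proof -
  obtain t where t: "theta_family n t" "no_short_relation n t"
    using theta_family_exists assms by blast
  let ?S = "t ` {..2 * n}"
  have "?S \<in> generating_theta_sets n"
    using theta_familyD(1)[OF t(1)] group_closure_family[OF t] theta_property_family[OF t]
    by (auto simp: generating_theta_sets_def)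
  moreover have "card ?S = 2 * n + 1"
    by (simp add: card_image inj_on_family[OF t])
  ultimately show ?thesis
    using sidon_family[OF t] by blast
qed

theorem theorem6p6:
  fixes n :: nat
  assumes "n \<ge> 10"
  shows "S_Sid n = M_Theta n \<and> M_Theta n = 2 * n + 1"
proof -
  obtain S where S: "S \<in> generating_theta_sets n" "sidon S" "card S = 2 * n + 1"
    using sidon_theta_set_exists assms by blast
  have le: "card T \<le> 2 * n + 1" if "T \<in> generating_theta_sets n" for T
    using that card_theta_property_le by (simp add: generating_theta_sets_def)
  \<comment> \<open>\<open>S\<close> attains both maxima, and \<open>le\<close> bounds both.\<close>
  have "M_Theta n = 2 * n + 1"
    unfolding M_Theta_def using S le
    by (intro Max_eqI) (auto simp: finite_generating_theta_sets intro: rev_image_eqI)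
  moreover have "S_Sid n = 2 * n + 1"
    unfolding S_Sid_def using S le
    by (intro Max_eqI) (auto simp: finite_generating_theta_sets intro: rev_image_eqI)
  ultimately show ?thesis
    by simp
qed

end
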